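(* Let $\mathbf{Matr}$ be the category of (finite) matroids and strong maps, let $\mathbf{FinSet}$ be the category of finite sets and functions, and let $|-|\colon\mathbf{Matr}\to\mathbf{FinSet}$ be the forgetful functor sending a matroid to its ground set. There is a series of adjunctions $$F\dashv |-|\dashv C\dashv (-)_0,$$ where $F,C\colon\mathbf{FinSet}\to\mathbf{Matr}$ and $(-)_0\colon\mathbf{Matr}\to\mathbf{FinSet}$ are given as follows: $F(X)$ is the matroid with ground set $X$ and family of flats $2^X$, and $F(f)=f$; $C(X)$ is the matroid with ground set $X$ and family of flats $\{X\}$, and $C(f)=f$; $(M)_0=F_0$ is the least flat of $M$ (the bottom element of its lattice of flats), and $(f)_0=f|_{F_0}$. There are no further adjoints: $F$ has no left adjoint and $(-)_0$ has no right adjoint.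
   Context: All matroids are finite. A matroid $M$ has a finite ground set $|M|$ (possibly empty) and a family $\mathcal{F}_M$ of flats (closed sets). A strong map from $M$ to $N$ is a function $f\colon|M|\to|N|$ such that the inverse image of any flat of $N$ is a flat of $M$. *)

theory Defs
  imports "HOL-Library.FuncSet"
begin

section \<open>Categories, functors, adjunctions\<close>

text \<open>
  Hom-sets need not be disjoint, so identities, composition and the action of a functor
  on arrows take the objects involved as arguments:
  \<open>Comp C X Y Z g f\<close> is the composite of \<open>f : X \<rightarrow> Y\<close> followed by \<open>g : Y \<rightarrow> Z\<close>,
  and \<open>Fmap F X Y f\<close> is the image of \<open>f : X \<rightarrow> Y\<close>.
\<close>

record ('o, 'm) category =
  Ob :: "'o set"
  Hom :: "'o \<Rightarrow> 'o \<Rightarrow> 'm set"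
  Ident :: "'o \<Rightarrow> 'm"
  Comp :: "'o \<Rightarrow> 'o \<Rightarrow> 'o \<Rightarrow> 'm \<Rightarrow> 'm \<Rightarrow> 'm"

locale category =
  fixes C :: "('o, 'm) category"
  assumes Ident_in_Hom: "X \<in> Ob C \<Longrightarrow> Ident C X \<in> Hom C X X"
    and Comp_in_Hom:
      "\<lbrakk>X \<in> Ob C; Y \<in> Ob C; Z \<in> Ob C; f \<in> Hom C X Y; g \<in> Hom C Y Z\<rbrakk>
        \<Longrightarrow> Comp C X Y Z g f \<in> Hom C X Z"
    and Comp_Ident_right:
      "\<lbrakk>X \<in> Ob C; Y \<in> Ob C; f \<in> Hom C X Y\<rbrakk> \<Longrightarrow> Comp C X X Y f (Ident C X) = f"
    and Comp_Ident_left: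
      "\<lbrakk>X \<in> Ob C; Y \<in> Ob C; f \<in> Hom C X Y\<rbrakk> \<Longrightarrow> Comp C X Y Y (Ident C Y) f = f"
    and Comp_assoc:
      "\<lbrakk>W \<in> Ob C; X \<in> Ob C; Y \<in> Ob C; Z \<in> Ob C;
        f \<in> Hom C W X; g \<in> Hom C X Y; h \<in> Hom C Y Z\<rbrakk>
        \<Longrightarrow> Comp C W Y Z h (Comp C W X Y g f) = Comp C W X Z (Comp C X Y Z h g) f"

record ('o1, 'm1, 'o2, 'm2) cat_functor =
  Fob :: "'o1 \<Rightarrow> 'o2"
  Fmap :: "'o1 \<Rightarrow> 'o1 \<Rightarrow> 'm1 \<Rightarrow> 'm2"

locale cat_functor = source: category C + target: category D
  for C :: "('o1, 'm1) category" and D :: "('o2, 'm2) category" +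
  fixes F :: "('o1, 'm1, 'o2, 'm2) cat_functor"
  assumes Fob_in_Ob: "X \<in> Ob C \<Longrightarrow> Fob F X \<in> Ob D"
    and Fmap_in_Hom:
      "\<lbrakk>X \<in> Ob C; Y \<in> Ob C; f \<in> Hom C X Y\<rbrakk>
        \<Longrightarrow> Fmap F X Y f \<in> Hom D (Fob F X) (Fob F Y)"
    and Fmap_Ident: "X \<in> Ob C \<Longrightarrow> Fmap F X X (Ident C X) = Ident D (Fob F X)"
    and Fmap_Comp:
      "\<lbrakk>X \<in> Ob C; Y \<in> Ob C; Z \<in> Ob C; f \<in> Hom C X Y; g \<in> Hom C Y Z\<rbrakk>
        \<Longrightarrow> Fmap F X Z (Comp C X Y Z g f)
          = Comp D (Fob F X) (Fob F Y) (Fob F Z) (Fmap F Y Z g) (Fmap F X Y f)"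

text \<open>
  An adjunction \<open>L \<stileturn> R\<close> between \<open>L : C \<rightarrow> D\<close> and \<open>R : D \<rightarrow> C\<close> is a family of bijections
  \<open>\<phi> X Y : Hom D (L X) Y \<rightarrow> Hom C X (R Y)\<close>, natural in \<open>X\<close> and in \<open>Y\<close>.
\<close>

locale adjunction = left: cat_functor C D L + right: cat_functor D C R
  for C :: "('o1, 'm1) category" and D :: "('o2, 'm2) category"
    and L :: "('o1, 'm1, 'o2, 'm2) cat_functor" and R :: "('o2, 'm2, 'o1, 'm1) cat_functor" +
  fixes \<phi> :: "'o1 \<Rightarrow> 'o2 \<Rightarrow> 'm2 \<Rightarrow> 'm1"
  assumes bij:
      "\<lbrakk>X \<in> Ob C; Y \<in> Ob D\<rbrakk>
        \<Longrightarrow> bij_betw (\<phi> X Y) (Hom D (Fob L X) Y) (Hom C X (Fob R Y))"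
    and natural_left:
      "\<lbrakk>X \<in> Ob C; X' \<in> Ob C; Y \<in> Ob D; f \<in> Hom C X' X; h \<in> Hom D (Fob L X) Y\<rbrakk>
        \<Longrightarrow> \<phi> X' Y (Comp D (Fob L X') (Fob L X) Y h (Fmap L X' X f))
          = Comp C X' X (Fob R Y) (\<phi> X Y h) f"
    and natural_right:
      "\<lbrakk>X \<in> Ob C; Y \<in> Ob D; Y' \<in> Ob D; g \<in> Hom D Y Y'; h \<in> Hom D (Fob L X) Y\<rbrakk>
        \<Longrightarrow> \<phi> X Y' (Comp D (Fob L X) Y Y' g h)
          = Comp C X (Fob R Y) (Fob R Y') (Fmap R Y Y' g) (\<phi> X Y h)"

definition is_adjoint ::
  "('o1, 'm1) category \<Rightarrow> ('o2, 'm2) category \<Rightarrow>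
   ('o1, 'm1, 'o2, 'm2) cat_functor \<Rightarrow> ('o2, 'm2, 'o1, 'm1) cat_functor \<Rightarrow> bool"
  where "is_adjoint C D L R \<longleftrightarrow> (\<exists>\<phi>. adjunction C D L R \<phi>)"

definition has_left_adjoint ::
  "('o2, 'm2) category \<Rightarrow> ('o1, 'm1) category \<Rightarrow> ('o2, 'm2, 'o1, 'm1) cat_functor \<Rightarrow> bool"
  where "has_left_adjoint D C R \<longleftrightarrow> (\<exists>L. is_adjoint C D L R)"

definition has_right_adjoint ::
  "('o1, 'm1) category \<Rightarrow> ('o2, 'm2) category \<Rightarrow> ('o1, 'm1, 'o2, 'm2) cat_functor \<Rightarrow> bool"
  where "has_right_adjoint C D L \<longleftrightarrow> (\<exists>R. is_adjoint C D L R)"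


section \<open>Matroids and strong maps\<close>

record 'a matroid =
  ground :: "'a set"
  flats :: "'a set set"

definition covers_flat :: "'a matroid \<Rightarrow> 'a set \<Rightarrow> 'a set \<Rightarrow> bool"
  where "covers_flat M A B \<longleftrightarrow>
    A \<in> flats M \<and> B \<in> flats M \<and> A \<subset> B \<and> \<not> (\<exists>D\<in>flats M. A \<subset> D \<and> D \<subset> B)"

text \<open>
  The axiomatisation of finite matroids by their flats: the ground set is a flat, flats are
  closed under intersection, and for every flat \<open>A\<close> the sets \<open>B - A\<close>, for the flats \<open>B\<close>
  covering \<open>A\<close>, partition the complement of \<open>A\<close>.
\<close>

definition is_matroid :: "'a matroid \<Rightarrow> bool"
  where "is_matroid M \<longleftrightarrow>
    finite (ground M) \<and>
    flats M \<subseteq> Pow (ground M) \<and>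
    ground M \<in> flats M \<and>
    (\<forall>A\<in>flats M. \<forall>B\<in>flats M. A \<inter> B \<in> flats M) \<and>
    (\<forall>A\<in>flats M. \<forall>x\<in>ground M - A. \<exists>!B. covers_flat M A B \<and> x \<in> B)"

text \<open>
  Maps are represented by functions that are \<open>undefined\<close> outside their domain, so that
  equality of maps is equality in HOL.
\<close>

definition strong_maps :: "'a matroid \<Rightarrow> 'b matroid \<Rightarrow> ('a \<Rightarrow> 'b) set"
  where "strong_maps M N =
    {f \<in> ground M \<rightarrow>\<^sub>E ground N. \<forall>B\<in>flats N. {x \<in> ground M. f x \<in> B} \<in> flats M}"

definition least_flat :: "'a matroid \<Rightarrow> 'a set"
  where "least_flat M = (LEAST A. A \<in> flats M)"

lemma least_flat:
  assumes "is_matroid M"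
  shows "least_flat M \<in> flats M" and "A \<in> flats M \<Longrightarrow> least_flat M \<subseteq> A"
proof -
  have fin: "finite (flats M)" and ne: "flats M \<noteq> {}"
    and cl: "\<And>A B. A \<in> flats M \<Longrightarrow> B \<in> flats M \<Longrightarrow> A \<inter> B \<in> flats M"
    using assms unfolding is_matroid_def by (auto intro: finite_subset)
  have "\<Inter>S \<in> flats M" if "finite S" "S \<noteq> {}" "S \<subseteq> flats M" for S
    using that by (induction S rule: finite_ne_induct) (auto intro: cl)
  then have "\<Inter>(flats M) \<in> flats M"
    using fin ne by blast
  moreover from this have "least_flat M = \<Inter>(flats M)"
    unfolding least_flat_def by (intro Least_equality) auto
  ultimately show "least_flat M \<in> flats M" and "A \<in> flats M \<Longrightarrow> least_flat M \<subseteq> A"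
    by auto
qed


section \<open>The categories and functors\<close>

text \<open>
  Elements are drawn from a type \<open>'a\<close> serving as the universe. If \<open>'a\<close> is infinite, every finite
  set is in bijection with an object of \<open>FinSet\<close>, and every matroid is isomorphic to an
  object of \<open>Matr\<close>.
\<close>

definition FinSet :: "('a set, 'a \<Rightarrow> 'a) category"
  where "FinSet =
    \<lparr>Ob = {X. finite X},
     Hom = (\<lambda>X Y. X \<rightarrow>\<^sub>E Y),
     Ident = (\<lambda>X. \<lambda>x\<in>X. x),
     Comp = (\<lambda>X Y Z g f. compose X g f)\<rparr>"

definition Matr :: "('a matroid, 'a \<Rightarrow> 'a) category"
  where "Matr =
    \<lparr>Ob = {M. is_matroid M},
     Hom = strong_maps,
     Ident = (\<lambda>M. \<lambda>x\<in>ground M. x),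
     Comp = (\<lambda>L M N g f. compose (ground L) g f)\<rparr>"

definition forgetful :: "('a matroid, 'a \<Rightarrow> 'a, 'a set, 'a \<Rightarrow> 'a) cat_functor"
  where "forgetful = \<lparr>Fob = ground, Fmap = (\<lambda>M N f. f)\<rparr>"

definition free_matroid :: "('a set, 'a \<Rightarrow> 'a, 'a matroid, 'a \<Rightarrow> 'a) cat_functor"
  where "free_matroid =
    \<lparr>Fob = (\<lambda>X. \<lparr>ground = X, flats = Pow X\<rparr>), Fmap = (\<lambda>X Y f. f)\<rparr>"

definition cofree_matroid :: "('a set, 'a \<Rightarrow> 'a, 'a matroid, 'a \<Rightarrow> 'a) cat_functor"
  where "cofree_matroid =
    \<lparr>Fob = (\<lambda>X. \<lparr>ground = X, flats = {X}\<rparr>), Fmap = (\<lambda>X Y f. f)\<rparr>"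

definition bottom_flat :: "('a matroid, 'a \<Rightarrow> 'a, 'a set, 'a \<Rightarrow> 'a) cat_functor"
  where "bottom_flat =
    \<lparr>Fob = least_flat, Fmap = (\<lambda>M N f. restrict f (least_flat M))\<rparr>"

end

theory Submission
  imports Defs
begin

text \<open>
  All three adjunctions are identities on hom-sets. Every function out of \<open>F(X)\<close> is strong
  because every subset of \<open>X\<close> is a flat of \<open>F(X)\<close>; every function into \<open>C(X)\<close> is strong because
  the only flat of \<open>C(X)\<close> is \<open>X\<close>; and a function \<open>X \<rightarrow> |M|\<close> is a strong map \<open>C(X) \<rightarrow> M\<close> iff every
  flat of \<open>M\<close> contains its image, that is, iff it is a function \<open>X \<rightarrow> M\<^sub>0\<close>.

  If \<open>F\<close> had a left adjoint, every strong map from a matroid \<open>M\<close> to a free matroid would factor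
  through one strong map \<open>\<eta>\<close> from \<open>M\<close> to a free matroid. This fails for the uniform matroid of
  rank 3 on four points. Partition it into two pairs: the map that collapses each pair to a point is
  a strong map to a free matroid, since the pairs are flats. Any two of the four points lie in
  different pairs of some such partition, so \<open>\<eta>\<close> is
  injective. Then every subset of \<open>M\<close> is the inverse image of a flat and so is itself a flat, yet
  the three-element subsets are not flats (\<open>free_matroid_no_left_adjoint\<close>).

  If \<open>(-)\<^sub>0\<close> had a right adjoint \<open>R\<close>, take \<open>Y\<close> with two elements and a one-element set \<open>1\<close>.
  As \<open>F(1)\<^sub>0\<close> is empty, there is exactly one function \<open>F(1)\<^sub>0 \<rightarrow> Y\<close>, hence exactly one strong
  map \<open>F(1) \<rightarrow> R(Y)\<close>, and \<open>R(Y)\<close> has exactly one point. As \<open>C(1)\<^sub>0 = 1\<close>, there are two functions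
  \<open>C(1)\<^sub>0 \<rightarrow> Y\<close>, hence two strong maps \<open>C(1) \<rightarrow> R(Y)\<close>, which is impossible
  (\<open>bottom_flat_no_right_adjoint\<close>).
\<close>

section \<open>Uniform matroids\<close>

text \<open>
  This is the uniform matroid of rank \<open>min r |X|\<close>. The free matroid is the case \<open>r = |X|\<close>, and
  the matroid whose only flat is \<open>X\<close> is the case \<open>r = 0\<close>.
\<close>

definition uniform_matroid :: "nat \<Rightarrow> 'a set \<Rightarrow> 'a matroid"
  where "uniform_matroid r X = \<lparr>ground = X, flats = insert X {A. A \<subseteq> X \<and> card A < r}\<rparr>"

text \<open>
  The flat covering \<open>A\<close> and containing \<open>x\<close> is \<open>insert x A\<close> as long as this set still has fewer
  than \<open>r\<close> elements; otherwise the only flat properly above \<open>A\<close> is \<open>X\<close>.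
\<close>

lemma is_matroid_uniform:
  assumes "finite X"
  shows "is_matroid (uniform_matroid r X)"
proof -
  let ?M = "uniform_matroid r X"
  have flat_iff: "A \<in> flats ?M \<longleftrightarrow> A = X \<or> A \<subseteq> X \<and> card A < r" for A
    by (auto simp: uniform_matroid_def)
  have ground: "ground ?M = X"
    by (simp add: uniform_matroid_def)
  have inter: "A \<inter> B \<in> flats ?M" if A: "A \<in> flats ?M" and B: "B \<in> flats ?M" for A B
  proof (cases "A = X \<or> B = X")
    case True
    then show ?thesis
      using A B by (auto simp: flat_iff Int_absorb1 Int_absorb2)
  next
    case False
    then have "A \<subseteq> X" "card A < r"
      using A by (auto simp: flat_iff)
    moreover have "card (A \<inter> B) \<le> card A"
      using \<open>A \<subseteq> X\<close> assms by (intro card_mono) (auto intro: finite_subset)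
    ultimately show ?thesis
      by (auto simp: flat_iff)
  qed
  have cover: "\<exists>!B. covers_flat ?M A B \<and> x \<in> B"
    if A: "A \<in> flats ?M" and x: "x \<in> X - A" for A x
  proof -
    have AX: "A \<subseteq> X" "card A < r"
      using A x by (auto simp: flat_iff)
    have fin: "finite B" if "B \<in> flats ?M" for B
      using that assms by (auto simp: flat_iff intro: finite_subset)
    show ?thesis
    proof (cases "insert x A \<in> flats ?M")
      case True
      have "covers_flat ?M A (insert x A)"
        using A True x unfolding covers_flat_def by blast
      moreover have "B = insert x A" if "covers_flat ?M A B \<and> x \<in> B" for B
        using that True x unfolding covers_flat_def by blast
      ultimately show ?thesis
        by blast
    next
      case False
      have top: "B = X" if "B \<in> flats ?M" "A \<subset> B" for B
      proof (rule ccontr)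
        assume "B \<noteq> X"
        then have "card B < r"
          using that by (auto simp: flat_iff)
        then have "Suc (card A) < r"
          using psubset_card_mono[OF fin[OF that(1)] that(2)] by simp
        then show False
          using False AX x fin[OF A] by (auto simp: flat_iff)
      qed
      have "covers_flat ?M A X"
        unfolding covers_flat_def
      proof (intro conjI)
        show "X \<in> flats ?M" "A \<subset> X"
          using AX(1) x by (auto simp: flat_iff)
        show "\<not> (\<exists>D\<in>flats ?M. A \<subset> D \<and> D \<subset> X)"
          using top by auto
      qed (rule A)
      moreover have "B = X" if "covers_flat ?M A B \<and> x \<in> B" for B
        using that by (intro top) (auto simp: covers_flat_def)
      ultimately show ?thesis
        using x by blast
    qed
  qed
  show ?thesis
    unfolding is_matroid_def ground
  proof (intro conjI ballI)
    show "flats ?M \<subseteq> Pow X" "X \<in> flats ?M"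
      by (auto simp: flat_iff)
  qed (fact assms inter cover)+
qed

lemma free_matroid_eq_uniform:
  assumes "finite X"
  shows "Fob free_matroid X = uniform_matroid (card X) X"
  using assms by (auto simp: free_matroid_def uniform_matroid_def intro: psubset_card_mono)

lemma cofree_matroid_eq_uniform: "Fob cofree_matroid X = uniform_matroid 0 X"
  by (simp add: cofree_matroid_def uniform_matroid_def)

lemma is_matroid_free: "finite X \<Longrightarrow> is_matroid (Fob free_matroid X)"
  by (simp add: free_matroid_eq_uniform is_matroid_uniform)

lemma is_matroid_cofree: "finite X \<Longrightarrow> is_matroid (Fob cofree_matroid X)"
  by (simp add: cofree_matroid_eq_uniform is_matroid_uniform)


section \<open>Strong maps\<close>

lemma strong_maps_compose:
  assumes "f \<in> strong_maps L M" and "g \<in> strong_maps M N"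
  shows "compose (ground L) g f \<in> strong_maps L N"
proof -
  have f: "f \<in> ground L \<rightarrow>\<^sub>E ground M" and g: "g \<in> ground M \<rightarrow>\<^sub>E ground N"
    using assms by (auto simp: strong_maps_def)
  have "{x \<in> ground L. compose (ground L) g f x \<in> B} \<in> flats L" if "B \<in> flats N" for B
  proof -
    have "{y \<in> ground M. g y \<in> B} \<in> flats M"
      using assms(2) that by (simp add: strong_maps_def)
    then have "{x \<in> ground L. f x \<in> {y \<in> ground M. g y \<in> B}} \<in> flats L"
      using assms(1) unfolding strong_maps_def by blast
    moreover have "{x \<in> ground L. compose (ground L) g f x \<in> B}
        = {x \<in> ground L. f x \<in> {y \<in> ground M. g y \<in> B}}"
      using f by (auto simp: compose_def)
    ultimately show ?thesis
      by (simp only:)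
  qed
  moreover have "compose (ground L) g f \<in> ground L \<rightarrow>\<^sub>E ground N"
    using f g by (auto simp: compose_def)
  ultimately show ?thesis
    by (simp add: strong_maps_def)
qed

lemma ident_strong:
  assumes "is_matroid M"
  shows "(\<lambda>x\<in>ground M. x) \<in> strong_maps M M"
proof -
  have "{x \<in> ground M. (\<lambda>x\<in>ground M. x) x \<in> B} = B" if "B \<in> flats M" for B
    using assms that by (auto simp: is_matroid_def)
  then show ?thesis
    by (auto simp: strong_maps_def)
qed

lemma strong_maps_from_free: "strong_maps (Fob free_matroid X) M = X \<rightarrow>\<^sub>E ground M"
  by (auto simp: strong_maps_def free_matroid_def)

lemma strong_maps_to_cofree:
  assumes "is_matroid M"
  shows "strong_maps M (Fob cofree_matroid X) = ground M \<rightarrow>\<^sub>E X"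
proof -
  have "{x \<in> ground M. f x \<in> X} = ground M" if "f \<in> ground M \<rightarrow>\<^sub>E X" for f
    using that by auto
  then show ?thesis
    using assms by (auto simp: strong_maps_def cofree_matroid_def is_matroid_def)
qed

lemma least_flat_subset_ground: "is_matroid M \<Longrightarrow> least_flat M \<subseteq> ground M"
  by (intro least_flat(2)) (simp_all add: is_matroid_def)

text \<open>
  Strongness of \<open>f\<close> means that the inverse image of every flat of \<open>M\<close> is all of \<open>X\<close>, so that \<open>f\<close>
  takes its values in the intersection of the flats.
\<close>

lemma strong_maps_from_cofree:
  assumes "is_matroid M"
  shows "strong_maps (Fob cofree_matroid X) M = X \<rightarrow>\<^sub>E least_flat M"
proof
  show "strong_maps (Fob cofree_matroid X) M \<subseteq> X \<rightarrow>\<^sub>E least_flat M"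
    using least_flat(1)[OF assms] by (force simp: strong_maps_def cofree_matroid_def)
next
  have sub: "least_flat M \<subseteq> B" if "B \<in> flats M" for B
    using least_flat(2)[OF assms that] .
  show "X \<rightarrow>\<^sub>E least_flat M \<subseteq> strong_maps (Fob cofree_matroid X) M"
    using sub least_flat_subset_ground[OF assms]
    by (fastforce simp: strong_maps_def cofree_matroid_def)
qed

text \<open>
  This makes \<open>(-)\<^sub>0\<close> a functor. The inverse image of \<open>N\<^sub>0\<close> is a flat of \<open>M\<close>, so it contains \<open>M\<^sub>0\<close>.
\<close>

lemma strong_map_least_flat:
  assumes "is_matroid M" and "is_matroid N" and "f \<in> strong_maps M N" and "x \<in> least_flat M"
  shows "f x \<in> least_flat N"
proof -
  have "{x \<in> ground M. f x \<in> least_flat N} \<in> flats M"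
    using assms(3) least_flat(1)[OF assms(2)] by (simp add: strong_maps_def)
  from least_flat(2)[OF assms(1) this] show ?thesis
    using assms(4) by auto
qed

lemma least_flat_free: "finite X \<Longrightarrow> least_flat (Fob free_matroid X) = {}"
  using least_flat(2)[OF is_matroid_free, of X "{}"] by (simp add: free_matroid_def)

lemma least_flat_cofree: "finite X \<Longrightarrow> least_flat (Fob cofree_matroid X) = X"
  using least_flat(1)[OF is_matroid_cofree, of X] by (simp add: cofree_matroid_def)


section \<open>The categories and functors\<close>

lemma FinSet_simps [simp]:
  "Ob FinSet = {X. finite X}"
  "Hom FinSet X Y = (X \<rightarrow>\<^sub>E Y)"
  "Ident FinSet X = (\<lambda>x\<in>X. x)"
  "Comp FinSet X Y Z g f = compose X g f"
  by (simp_all add: FinSet_def)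

lemma Matr_simps [simp]:
  "Ob Matr = {M. is_matroid M}"
  "Hom Matr M N = strong_maps M N"
  "Ident Matr M = (\<lambda>x\<in>ground M. x)"
  "Comp Matr L M N g f = compose (ground L) g f"
  by (simp_all add: Matr_def)

lemma functor_simps [simp]:
  "Fob forgetful M = ground M"
  "Fmap forgetful M N f = f"
  "Fmap free_matroid X Y f = f"
  "Fmap cofree_matroid X Y f = f"
  "Fob bottom_flat M = least_flat M"
  "Fmap bottom_flat M N f = restrict f (least_flat M)"
  by (simp_all add: forgetful_def free_matroid_def cofree_matroid_def bottom_flat_def)

lemma ground_free [simp]: "ground (Fob free_matroid X) = X"
  by (simp add: free_matroid_def)

lemma ground_cofree [simp]: "ground (Fob cofree_matroid X) = X"
  by (simp add: cofree_matroid_def)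

lemma strong_maps_funcset: "f \<in> strong_maps M N \<Longrightarrow> f \<in> ground M \<rightarrow>\<^sub>E ground N"
  by (simp add: strong_maps_def)

lemma compose_ident_right: "f \<in> X \<rightarrow>\<^sub>E Y \<Longrightarrow> compose X f (\<lambda>x\<in>X. x) = f"
  by (auto simp: compose_def fun_eq_iff PiE_def extensional_def)

lemma compose_ident_left: "f \<in> X \<rightarrow>\<^sub>E Y \<Longrightarrow> compose X (\<lambda>x\<in>Y. x) f = f"
  by (auto simp: compose_def fun_eq_iff PiE_def extensional_def)

lemma compose_PiE: "f \<in> X \<rightarrow>\<^sub>E Y \<Longrightarrow> g \<in> Y \<rightarrow>\<^sub>E Z \<Longrightarrow> compose X g f \<in> X \<rightarrow>\<^sub>E Z"
  by (auto simp: compose_def)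

lemma compose_assoc_PiE:
  "f \<in> W \<rightarrow>\<^sub>E X \<Longrightarrow> compose W h (compose W g f) = compose W (compose X h g) f"
  by (auto simp: compose_def fun_eq_iff)

lemma category_FinSet: "category FinSet"
  by unfold_locales
    (auto simp: compose_ident_left compose_ident_right compose_PiE compose_assoc_PiE)

lemma category_Matr: "category Matr"
  by unfold_locales
    (simp_all add: ident_strong strong_maps_compose compose_ident_left[OF strong_maps_funcset]
      compose_ident_right[OF strong_maps_funcset] compose_assoc_PiE[OF strong_maps_funcset])

lemma cat_functor_forgetful: "cat_functor Matr FinSet forgetful"
  by (intro cat_functor.intro category_Matr category_FinSet cat_functor_axioms.intro)
    (auto simp: is_matroid_def strong_maps_funcset)

lemma cat_functor_free: "cat_functor FinSet Matr free_matroid"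
  by (intro cat_functor.intro category_Matr category_FinSet cat_functor_axioms.intro)
    (auto simp: is_matroid_free strong_maps_from_free)

lemma cat_functor_cofree: "cat_functor FinSet Matr cofree_matroid"
  by (intro cat_functor.intro category_Matr category_FinSet cat_functor_axioms.intro)
    (auto simp: is_matroid_cofree strong_maps_to_cofree)

lemma cat_functor_bottom: "cat_functor Matr FinSet bottom_flat"
proof (intro cat_functor.intro category_Matr category_FinSet cat_functor_axioms.intro)
  show "Fob bottom_flat M \<in> Ob FinSet" if "M \<in> Ob Matr" for M :: "'a matroid"
    using that least_flat_subset_ground[of M]
    by (auto simp: is_matroid_def intro: finite_subset)
  show "Fmap bottom_flat M M (Ident Matr M) = Ident FinSet (Fob bottom_flat M)"
    if "M \<in> Ob Matr" for M :: "'a matroid"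
    using that least_flat_subset_ground[of M] by (auto simp: fun_eq_iff)
  show "Fmap bottom_flat M N f \<in> Hom FinSet (Fob bottom_flat M) (Fob bottom_flat N)"
    if "M \<in> Ob Matr" "N \<in> Ob Matr" "f \<in> Hom Matr M N" for M N :: "'a matroid" and f
    using that by (auto intro: strong_map_least_flat)
  show "Fmap bottom_flat L N (Comp Matr L M N g f)
      = Comp FinSet (Fob bottom_flat L) (Fob bottom_flat M) (Fob bottom_flat N)
          (Fmap bottom_flat M N g) (Fmap bottom_flat L M f)"
    if "L \<in> Ob Matr" "M \<in> Ob Matr" "f \<in> Hom Matr L M"
    for L M N :: "'a matroid" and f g
    using that least_flat_subset_ground[of L] strong_map_least_flat[of L M f]
    by (auto simp: compose_def fun_eq_iff)
qed


section \<open>The three adjunctions\<close>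

lemma adjunction_free_forgetful: "adjunction FinSet Matr free_matroid forgetful (\<lambda>X M h. h)"
  by (intro adjunction.intro cat_functor_free cat_functor_forgetful adjunction_axioms.intro)
    (auto simp: bij_betw_def strong_maps_from_free)

lemma adjunction_forgetful_cofree: "adjunction Matr FinSet forgetful cofree_matroid (\<lambda>M X h. h)"
  by (intro adjunction.intro cat_functor_forgetful cat_functor_cofree adjunction_axioms.intro)
    (auto simp: bij_betw_def strong_maps_to_cofree)

lemma adjunction_cofree_bottom: "adjunction FinSet Matr cofree_matroid bottom_flat (\<lambda>X M h. h)"
  by (intro adjunction.intro cat_functor_cofree cat_functor_bottom adjunction_axioms.intro)
    (auto simp: bij_betw_def strong_maps_from_cofree compose_def fun_eq_iff)


section \<open>The series does not extend\<close>

text \<open>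
  The universal property of the unit, the image of the identity of \<open>L X\<close>: naturality in \<open>Y\<close>
  carries \<open>g = g \<circ> id\<close> to the factorisation of the arrow that corresponds to \<open>g\<close>.
\<close>

lemma (in adjunction) unit_factorization:
  assumes X: "X \<in> Ob C"
  obtains \<eta> where "\<eta> \<in> Hom C X (Fob R (Fob L X))"
    and "\<And>Y f. Y \<in> Ob D \<Longrightarrow> f \<in> Hom C X (Fob R Y) \<Longrightarrow>
      \<exists>g\<in>Hom D (Fob L X) Y. f = Comp C X (Fob R (Fob L X)) (Fob R Y) (Fmap R (Fob L X) Y g) \<eta>"
proof
  let ?i = "Ident D (Fob L X)"
  have LX: "Fob L X \<in> Ob D"
    using X by (rule left.Fob_in_Ob)
  then have i: "?i \<in> Hom D (Fob L X) (Fob L X)"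
    by (rule left.target.Ident_in_Hom)
  show "\<phi> X (Fob L X) ?i \<in> Hom C X (Fob R (Fob L X))"
    using bij[OF X LX] i by (rule bij_betw_apply)
  fix Y f
  assume Y: "Y \<in> Ob D" and f: "f \<in> Hom C X (Fob R Y)"
  obtain g where g: "g \<in> Hom D (Fob L X) Y" and fg: "f = \<phi> X Y g"
    using bij[OF X Y] f unfolding bij_betw_def by blast
  have "\<phi> X Y g = Comp C X (Fob R (Fob L X)) (Fob R Y) (Fmap R (Fob L X) Y g) (\<phi> X (Fob L X) ?i)"
    using natural_right[OF X LX Y g i] left.target.Comp_Ident_right[OF LX Y g] by simp
  then show "\<exists>g\<in>Hom D (Fob L X) Y. f =
      Comp C X (Fob R (Fob L X)) (Fob R Y) (Fmap R (Fob L X) Y g) (\<phi> X (Fob L X) ?i)"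
    using g fg by blast
qed

lemma strong_maps_to_free_iff:
  "f \<in> strong_maps M (Fob free_matroid X) \<longleftrightarrow>
    f \<in> ground M \<rightarrow>\<^sub>E X \<and> (\<forall>B\<subseteq>X. {x \<in> ground M. f x \<in> B} \<in> flats M)"
  by (auto simp: strong_maps_def free_matroid_def)

lemma inj_strong_map_to_free:
  assumes "f \<in> strong_maps M (Fob free_matroid X)" and "inj_on f (ground M)"
    and "A \<subseteq> ground M"
  shows "A \<in> flats M"
proof -
  have "f ` A \<subseteq> X"
    using assms(1,3) by (auto simp: strong_maps_to_free_iff)
  then have "{x \<in> ground M. f x \<in> f ` A} \<in> flats M"
    using assms(1) unfolding strong_maps_to_free_iff by blast
  also have "{x \<in> ground M. f x \<in> f ` A} = A"
    using assms(2,3) by (auto dest: inj_onD)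
  finally show ?thesis .
qed

lemma four_distinct_points:
  assumes "infinite (UNIV :: 'a set)"
  obtains a b c d :: 'a where "distinct [a, b, c, d]"
proof -
  obtain A :: "'a set" where "finite A" "card A = 4"
    using infinite_arbitrarily_large[OF assms] by blast
  moreover obtain xs where "set xs = A" "distinct xs"
    using \<open>finite A\<close> finite_distinct_list by blast
  ultimately have "length xs = Suc (Suc (Suc (Suc 0)))" "distinct xs"
    by (auto simp: distinct_card[symmetric])
  then show ?thesis
    using that by (auto simp: length_Suc_conv)
qed

text \<open>
  The fibres of a strong map to a free matroid form a partition all of whose unions of blocks are
  flats. The unit \<open>\<eta>\<close> of an adjunction would make the common refinement of all such
  partitions again one of them. In the uniform matroid of rank 3 on four points the partitions into
  two pairs qualify, but their common refinement, the partition into points, does not.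
\<close>

lemma free_matroid_no_left_adjoint:
  assumes "infinite (UNIV :: 'a set)"
  shows "\<not> has_left_adjoint FinSet Matr
    (free_matroid :: ('a set, 'a \<Rightarrow> 'a, 'a matroid, 'a \<Rightarrow> 'a) cat_functor)"
proof
  assume "has_left_adjoint FinSet Matr
    (free_matroid :: ('a set, 'a \<Rightarrow> 'a, 'a matroid, 'a \<Rightarrow> 'a) cat_functor)"
  then obtain L :: "('a matroid, 'a \<Rightarrow> 'a, 'a set, 'a \<Rightarrow> 'a) cat_functor" and \<phi>
    where adj: "adjunction Matr FinSet L free_matroid \<phi>"
    unfolding has_left_adjoint_def is_adjoint_def by blast
  obtain a b c d :: 'a where abcd: "distinct [a, b, c, d]"
    using four_distinct_points[OF assms] .
  define E where "E = {a, b, c, d}"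
  define M where "M = uniform_matroid 3 E"
  have M: "M \<in> Ob Matr"
    by (simp add: M_def E_def is_matroid_uniform)
  have ground: "ground M = E"
    by (simp add: M_def uniform_matroid_def)
  have flat_iff: "A \<in> flats M \<longleftrightarrow> A = E \<or> A \<subseteq> E \<and> card A < 3" for A
    by (auto simp: M_def uniform_matroid_def)
  obtain \<eta> where \<eta>: "\<eta> \<in> Hom Matr M (Fob free_matroid (Fob L M))"
    and factor: "\<And>Y f. Y \<in> Ob FinSet \<Longrightarrow> f \<in> Hom Matr M (Fob free_matroid Y) \<Longrightarrow>
      \<exists>g\<in>Hom FinSet (Fob L M) Y.
        f = Comp Matr M (Fob free_matroid (Fob L M)) (Fob free_matroid Y)
          (Fmap free_matroid (Fob L M) Y g) \<eta>"
    using adjunction.unit_factorization[OF adj M] by blast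
  have separates: "\<eta> x \<noteq> \<eta> y"
    if "P \<subseteq> E" "card P = 2" "card (E - P) = 2" "x \<in> P" "y \<in> E - P" for P x y
  proof
    assume eq: "\<eta> x = \<eta> y"
    \<comment> \<open>This map collapses each of the two pairs to one of its elements; as it factors through
      \<open>\<eta>\<close>, it cannot tell \<open>x\<close> from \<open>y\<close> either.\<close>
    define f where "f = (\<lambda>z\<in>E. if z \<in> P then x else y)"
    have "{z \<in> E. f z \<in> B} \<in> flats M" for B
    proof -
      have "{z \<in> E. f z \<in> B} = (if x \<in> B then P else {}) \<union> (if y \<in> B then E - P else {})"
        using \<open>P \<subseteq> E\<close> by (auto simp: f_def)
      moreover have "P \<union> (E - P) = E"
        using \<open>P \<subseteq> E\<close> by blast
      ultimately show ?thesis
        using that(1-3) by (simp add: flat_iff)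
    qed
    moreover have "f \<in> E \<rightarrow>\<^sub>E {x, y}"
      by (auto simp: f_def)
    ultimately have "f \<in> Hom Matr M (Fob free_matroid {x, y})"
      by (simp add: strong_maps_to_free_iff ground)
    then obtain g where "f = compose E g \<eta>"
      using factor[of "{x, y}" f] ground by auto
    then have "f x = f y"
      using eq that by (auto simp: compose_def)
    then show False
      using that by (auto simp: f_def)
  qed
  have pair: "\<eta> x \<noteq> \<eta> y" if "distinct [x, z, y, w]" "E = {x, z, y, w}" for x y z w
  proof -
    have "E - {x, z} = {y, w}"
      using that by auto
    then show ?thesis
      using separates[of "{x, z}" x y] that by auto
  qed
  have "\<eta> a \<noteq> \<eta> b" "\<eta> a \<noteq> \<eta> c" "\<eta> a \<noteq> \<eta> d" "\<eta> b \<noteq> \<eta> c" "\<eta> b \<noteq> \<eta> d" "\<eta> c \<noteq> \<eta> d"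
    using pair[of a c b d] pair[of a b c d] pair[of a b d c] pair[of b a c d] pair[of b a d c]
      pair[of c a d b] abcd by (auto simp: E_def insert_commute)
  then have "inj_on \<eta> (ground M)"
    by (auto simp: ground E_def inj_on_def)
  then have "{a, b, c} \<in> flats M"
    using \<eta> by (intro inj_strong_map_to_free[of \<eta> M "Fob L M"]) (auto simp: ground E_def)
  then show False
    using abcd by (auto simp: flat_iff E_def)
qed

text \<open>
  The argument counts hom-sets: on one point \<open>a\<close>, the free matroid determines the number of points
  of \<open>R {a, b}\<close>, and the matroid whose only flat is \<open>{a}\<close> then has too many strong maps to it.
\<close>

lemma bottom_flat_no_right_adjoint:
  assumes "infinite (UNIV :: 'a set)"
  shows "\<not> has_right_adjoint Matr FinSet
    (bottom_flat :: ('a matroid, 'a \<Rightarrow> 'a, 'a set, 'a \<Rightarrow> 'a) cat_functor)"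
proof
  assume "has_right_adjoint Matr FinSet
    (bottom_flat :: ('a matroid, 'a \<Rightarrow> 'a, 'a set, 'a \<Rightarrow> 'a) cat_functor)"
  then obtain R :: "('a set, 'a \<Rightarrow> 'a, 'a matroid, 'a \<Rightarrow> 'a) cat_functor" and \<phi>
    where "adjunction Matr FinSet bottom_flat R \<phi>"
    unfolding has_right_adjoint_def is_adjoint_def by blast
  then interpret adjunction Matr FinSet bottom_flat R \<phi> .
  obtain a b c d :: 'a where "distinct [a, b, c, d]"
    using four_distinct_points[OF assms] .
  then have "a \<noteq> b"
    by simp
  define N where "N = Fob R {a, b}"
  have N: "is_matroid N"
    using right.Fob_in_Ob[of "{a, b}"] by (simp add: N_def)
  have hom_card: "card (strong_maps M N) = card (least_flat M \<rightarrow>\<^sub>E {a, b})"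
    if "is_matroid M" for M :: "'a matroid"
    using bij_betw_same_card[OF bij[of M "{a, b}"]] that by (simp add: N_def)
  have "card (strong_maps (Fob free_matroid {a}) N) = 1"
    by (simp add: hom_card is_matroid_free least_flat_free)
  then have one: "card (ground N) = 1"
    by (simp add: strong_maps_from_free card_PiE)
  have "finite ({a} \<rightarrow>\<^sub>E ground N)"
    using N by (intro finite_PiE) (auto simp: is_matroid_def)
  moreover have "strong_maps (Fob cofree_matroid {a}) N \<subseteq> {a} \<rightarrow>\<^sub>E ground N"
    using strong_maps_funcset by force
  ultimately have "card (strong_maps (Fob cofree_matroid {a}) N) \<le> 1"
    using card_mono one by (fastforce simp: card_PiE)
  moreover have "card (strong_maps (Fob cofree_matroid {a}) N) = 2"
    using \<open>a \<noteq> b\<close> by (simp add: hom_card is_matroid_cofree least_flat_cofree card_PiE)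
  ultimately show False
    by simp
qed

theorem theorem2p9:
  assumes "infinite (UNIV :: 'a set)"
  shows "is_adjoint FinSet Matr
           (free_matroid :: ('a set, 'a \<Rightarrow> 'a, 'a matroid, 'a \<Rightarrow> 'a) cat_functor) forgetful
       \<and> is_adjoint Matr FinSet
           (forgetful :: ('a matroid, 'a \<Rightarrow> 'a, 'a set, 'a \<Rightarrow> 'a) cat_functor) cofree_matroid
       \<and> is_adjoint FinSet Matr
           (cofree_matroid :: ('a set, 'a \<Rightarrow> 'a, 'a matroid, 'a \<Rightarrow> 'a) cat_functor) bottom_flat
       \<and> \<not> has_left_adjoint FinSet Matr
           (free_matroid :: ('a set, 'a \<Rightarrow> 'a, 'a matroid, 'a \<Rightarrow> 'a) cat_functor)
       \<and> \<not> has_right_adjoint Matr FinSet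
           (bottom_flat :: ('a matroid, 'a \<Rightarrow> 'a, 'a set, 'a \<Rightarrow> 'a) cat_functor)"
  unfolding is_adjoint_def
  using adjunction_free_forgetful adjunction_forgetful_cofree adjunction_cofree_bottom
    free_matroid_no_left_adjoint[OF assms] bottom_flat_no_right_adjoint[OF assms]
  by blast

end
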